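(* Let $\{a_{n,i}\}$, $n=0,1,2,\dots$, $i=0,1,\dots,n$, and $\{\delta_n^{(k)}\}$, $n=0,1,2,\dots$, $k=0,1,\dots,n$, be two (doubly indexed) sequences of complex numbers. Then the following two statements are equivalent: 1. For each $n=0,1,2,\dots$, $$\delta_n^{(k)}=\sum_{i=k}^{n}\binom{n}{i}\, i!\,a_{i,i-k},\qquad k=0,1,\ldots,n.$$ 2. For each $n=0,1,2,\dots$, $$n!\,a_{n,n-k}=\sum_{i=k}^{n}\binom{n}{i}(-1)^{n-i}\delta_i^{(k)},\qquad k=0,1,\ldots,n.$$ *)

theory Defs
  imports Complex_Main
begin

end

theory Submission
  imports Defs
begin

text \<open>
  For each fixed \<open>k\<close>, the substitution \<open>f i = \<delta> i k\<close>, \<open>g i = fact i * a i (i - k)\<close> turns the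
  claim into binomial inversion for sequences indexed from \<open>k\<close> on
  (\<open>binomial_inversion_from\<close>); different values of \<open>k\<close> do not interact.
  Binomial inversion says that the lower triangular matrices with entries
  \<open>n choose i\<close> and \<open>(-1)^(n-i) (n choose i)\<close> are inverse to each other.  Multiplying the
  sequence \<open>g\<close> by \<open>(-1)^i\<close> gives both directions from one fact, namely that the matrix
  with entries \<open>(-1)^i (n choose i)\<close> is its own inverse (\<open>signed_binomial_transform_involution\<close>).
  Its square is computed in \<open>signed_binomial_orthogonality\<close>; truncation to indices at
  least \<open>k\<close> does no harm because the matrix is triangular.
\<close>

text \<open>
  Choosing \<open>i\<close> out of \<open>n\<close> and then \<open>j\<close> out of \<open>i\<close> amounts to choosing \<open>j\<close> out of \<open>n\<close> and then
  the other \<open>i - j\<close> out of \<open>n - j\<close>.  So the sum is, up to a factor, the expansion of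
  \<open>(1 - 1)^(n - j)\<close>, which vanishes unless \<open>n = j\<close>.
\<close>
lemma signed_binomial_orthogonality:
  assumes "j \<le> n"
  shows "(\<Sum>i=j..n. (-1) ^ i * of_nat (n choose i) * ((-1) ^ j * of_nat (i choose j)))
           = (if n = j then 1 else 0 :: 'a::comm_ring_1)"
proof -
  have sign: "(-1) ^ (i + j) * (-1) ^ j = ((-1) ^ i :: 'a)" for i
    by (cases "even j") (simp_all add: power_add)
  have "(\<Sum>i=j..n. (-1) ^ i * of_nat (n choose i) * ((-1) ^ j * of_nat (i choose j)))
      = (\<Sum>i=j..n. (-1) ^ i * (-1) ^ j * (of_nat ((n choose i) * (i choose j)) :: 'a))"
    by (simp add: mult_ac)
  also have "\<dots> = (\<Sum>i=j..n. (-1) ^ i * (-1) ^ j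
                      * of_nat ((n choose j) * ((n - j) choose (i - j))))"
    by (intro sum.cong refl) (simp only: atLeastAtMost_iff choose_mult)
  also have "\<dots> = (\<Sum>i\<le>n - j. (-1) ^ (i + j) * (-1) ^ j
                      * of_nat ((n choose j) * ((n - j) choose i)))"
    by (rule sum.reindex_bij_witness[of _ "\<lambda>i. i + j" "\<lambda>i. i - j"]) (use assms in auto)
  also have "\<dots> = of_nat (n choose j) * (\<Sum>i\<le>n - j. (-1) ^ i * of_nat ((n - j) choose i))"
    unfolding sign by (simp add: sum_distrib_left mult_ac)
  also have "\<dots> = (if n = j then 1 else 0)"
    using assms by (simp add: choose_alternating_sum)
  finally show ?thesis .
qed

lemma signed_binomial_transform_involution:
  fixes f g :: "nat \<Rightarrow> 'a::comm_ring_1"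
  assumes f: "\<And>m. k \<le> m \<Longrightarrow> f m = (\<Sum>i=k..m. (-1) ^ i * of_nat (m choose i) * g i)"
    and "k \<le> n"
  shows "g n = (\<Sum>i=k..n. (-1) ^ i * of_nat (n choose i) * f i)"
proof -
  have "(\<Sum>i=k..n. (-1) ^ i * of_nat (n choose i) * f i)
      = (\<Sum>i=k..n. \<Sum>j=k..i.
           (-1) ^ i * of_nat (n choose i) * ((-1) ^ j * of_nat (i choose j)) * g j)"
    by (intro sum.cong refl) (simp add: f sum_distrib_left mult.assoc)
  also have "\<dots> = (\<Sum>j=k..n. \<Sum>i=j..n.
           (-1) ^ i * of_nat (n choose i) * ((-1) ^ j * of_nat (i choose j)) * g j)"
    unfolding sum.Sigma[OF finite_atLeastAtMost ballI[OF finite_atLeastAtMost]]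
    by (rule sum.reindex_bij_witness[of _ prod.swap prod.swap]) auto
  also have "\<dots> = (\<Sum>j=k..n. if n = j then g j else 0)"
    by (intro sum.cong refl)
      (simp add: signed_binomial_orthogonality flip: sum_distrib_right)
  also have "\<dots> = g n"
    using \<open>k \<le> n\<close> by simp
  finally show ?thesis by simp
qed

text \<open>
  Binomial inversion in the usual form is the involution applied to the pair of \<open>f\<close> and
  \<open>\<lambda>i. (-1) ^ i * g i\<close>, in either order.
\<close>
lemma binomial_inversion_from:
  fixes f g :: "nat \<Rightarrow> 'a::comm_ring_1"
  shows "(\<forall>n\<ge>k. f n = (\<Sum>i=k..n. of_nat (n choose i) * g i))
     \<longleftrightarrow> (\<forall>n\<ge>k. g n = (\<Sum>i=k..n. of_nat (n choose i) * (-1) ^ (n - i) * f i))"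
proof -
  define h where "h = (\<lambda>i. (-1) ^ i * g i)"
  have sq: "(-1) ^ n * ((-1) ^ n * x) = x" for n and x :: 'a
    by (cases "even n") simp_all
  have sum_g: "(\<Sum>i=k..n. of_nat (n choose i) * g i)
      = (\<Sum>i=k..n. (-1) ^ i * of_nat (n choose i) * h i)" for n
    by (intro sum.cong refl) (simp add: h_def sq mult_ac)
  have sum_f: "(\<Sum>i=k..n. of_nat (n choose i) * (-1) ^ (n - i) * f i)
      = (-1) ^ n * (\<Sum>i=k..n. (-1) ^ i * of_nat (n choose i) * f i)" for n
  proof -
    have "(-1) ^ (n - i) = ((-1) ^ n * (-1) ^ i :: 'a)" if "i \<le> n" for i
      using that by (cases "even n"; cases "even i") simp_all
    then show ?thesis
      by (simp add: sum_distrib_left mult_ac)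
  qed
  have g_iff: "g n = (-1) ^ n * y \<longleftrightarrow> h n = y" for n y
    unfolding h_def by (metis sq)
  show ?thesis
    unfolding sum_g sum_f g_iff
    using signed_binomial_transform_involution[of k f h]
      signed_binomial_transform_involution[of k h f] by blast
qed

theorem theorem1:
  fixes a :: "nat \<Rightarrow> nat \<Rightarrow> complex" and \<delta> :: "nat \<Rightarrow> nat \<Rightarrow> complex"
  shows "(\<forall>n. \<forall>k\<in>{0..n}.
            \<delta> n k = (\<Sum>i=k..n. of_nat (n choose i) * fact i * a i (i - k)))
     \<longleftrightarrow> (\<forall>n. \<forall>k\<in>{0..n}.
            fact n * a n (n - k) = (\<Sum>i=k..n. of_nat (n choose i) * (-1) ^ (n - i) * \<delta> i k))"
proof -
  have "(\<forall>n\<ge>k. \<delta> n k = (\<Sum>i=k..n. of_nat (n choose i) * fact i * a i (i - k)))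
     \<longleftrightarrow> (\<forall>n\<ge>k. fact n * a n (n - k)
                  = (\<Sum>i=k..n. of_nat (n choose i) * (-1) ^ (n - i) * \<delta> i k))" for k
    using binomial_inversion_from[of k "\<lambda>n. \<delta> n k" "\<lambda>n. fact n * a n (n - k)"]
    by (simp add: mult.assoc)
  then show ?thesis
    unfolding atLeastAtMost_iff Ball_def by blast
qed

end
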